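(* Let $\delta>0$ be a constant and $p=1/2$. Then asymptotically almost surely (i.e. with probability tending to $1$ as $n\to\infty$) the random graph $G(n,1/2)$ satisfies $$w(G(n,1/2)) \ge (1-\delta)\log_2 n .$$
   Context: $G(n,p)$ is the random graph on $n$ labeled vertices in which each of the $\binom n2$ possible edges is present independently with probability $p$. All graphs are simple. A graph homomorphism $\phi:G\to H$ is a map $V(G)\to V(H)$ sending edges to edges; $\mathrm{Hom}(G,H)$ denotes the set of homomorphisms. For $d\ge 0$, $T^d$ is the infinite rooted tree in which the root has $d$ children and every other vertex also has exactly $d$ children. A map $\varphi\in\mathrm{Hom}(T^d,G)$ is called cold if there is a vertex $a$ of $G$ such that for every $k$ there is no $\psi\in\mathrm{Hom}(T^d,G)$ that agrees with $\varphi$ on all vertices at distance $k$ from the root $r$ and has $\psi(r)=a$. A graph $G$ is $d$-warm if $\mathrm{Hom}(T^{d-2},G)$ contains no cold maps, and the warmth $w(G)$ is the largest $d$ for which $G$ is $d$-warm. *)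

theory Defs
  imports "HOL-Probability.Probability" "HOL-Probability.Product_PMF"
begin

record 'a graph =
  verts :: "'a set"
  edges :: "'a set set"

definition all_edges :: "'a set \<Rightarrow> 'a set set" where
  "all_edges V = {e. e \<subseteq> V \<and> card e = 2}"

definition simple_graph :: "'a graph \<Rightarrow> bool" where
  "simple_graph G \<longleftrightarrow> edges G \<subseteq> all_edges (verts G)"

definition random_graph :: "nat \<Rightarrow> real \<Rightarrow> nat graph pmf" where
  "random_graph n p =
     map_pmf (\<lambda>present. \<lparr>verts = {..<n}, edges = {e \<in> all_edges {..<n}. present e}\<rparr>)
       (Pi_pmf (all_edges {..<n}) False (\<lambda>_. bernoulli_pmf p))"

definition graph_hom :: "'a graph \<Rightarrow> 'b graph \<Rightarrow> ('a \<Rightarrow> 'b) set" where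
  "graph_hom G H =
     {\<phi> \<in> verts G \<rightarrow>\<^sub>E verts H. \<forall>e \<in> edges G. \<phi> ` e \<in> edges H}"

text \<open>
  A vertex of the tree is the word over \<open>{..<d}\<close> recording the path from it to the root:
  the root is \<open>[]\<close>, the children of \<open>v\<close> are the words \<open>i # v\<close>, and the distance of \<open>v\<close> from
  the root is \<open>length v\<close>.
\<close>

definition tree :: "nat \<Rightarrow> nat list graph" where
  "tree d = \<lparr>verts = lists {..<d}, edges = {{v, i # v} | v i. v \<in> lists {..<d} \<and> i < d}\<rparr>"

definition cold :: "nat \<Rightarrow> 'a graph \<Rightarrow> (nat list \<Rightarrow> 'a) \<Rightarrow> bool" where
  "cold d G \<phi> \<longleftrightarrow>
     (\<exists>a \<in> verts G. \<forall>k. \<not> (\<exists>\<psi> \<in> graph_hom (tree d) G.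
        (\<forall>v \<in> verts (tree d). length v = k \<longrightarrow> \<psi> v = \<phi> v) \<and> \<psi> [] = a))"

definition warm :: "nat \<Rightarrow> 'a graph \<Rightarrow> bool" where
  "warm d G \<longleftrightarrow> 2 \<le> d \<and> \<not> (\<exists>\<phi> \<in> graph_hom (tree (d - 2)) G. cold (d - 2) G \<phi>)"

text \<open>
  A supremum in \<^typ>\<open>enat\<close>, because a graph without edges is \<open>d\<close>-warm for every \<open>d \<ge> 2\<close>
  (there are no homomorphisms from a tree with an edge); its warmth is \<open>\<infinity>\<close>.  Whenever a
  largest \<open>d\<close> exists, the supremum is that \<open>d\<close> (lemma \<open>warmth_eq_Max\<close>).
\<close>

definition warmth :: "'a graph \<Rightarrow> enat" where
  "warmth G = (SUP d \<in> {d. warm d G}. enat d)"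

lemma simple_graph_random_graph:
  assumes "G \<in> set_pmf (random_graph n p)"
  shows "simple_graph G"
  using assms by (auto simp: random_graph_def simple_graph_def)

lemma simple_graph_tree: "simple_graph (tree d)"
proof -
  have "card {v, i # v} = 2" for v :: "nat list" and i
    by (simp add: card_insert_if not_Cons_self2[symmetric])
  then show ?thesis
    by (auto simp: simple_graph_def tree_def all_edges_def)
qed

lemma warm_2: "warm 2 G"
proof -
  have "\<not> cold 0 G \<phi>" for \<phi> :: "nat list \<Rightarrow> 'a"
  proof
    assume "cold 0 G \<phi>"
    then obtain a where a: "a \<in> verts G"
      and *: "\<And>k. \<not> (\<exists>\<psi> \<in> graph_hom (tree 0) G.
        (\<forall>v \<in> verts (tree 0). length v = k \<longrightarrow> \<psi> v = \<phi> v) \<and> \<psi> [] = a)"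
      by (auto simp: cold_def)
    have "(\<lambda>v \<in> {[]}. a) \<in> graph_hom (tree 0) G"
      using a by (auto simp: graph_hom_def tree_def)
    with *[of 1] show False
      by (auto simp: tree_def)
  qed
  then show ?thesis
    by (simp add: warm_def)
qed

lemma warmth_eq_Max:
  assumes "finite {d. warm d G}"
  shows "warmth G = enat (Max {d. warm d G})"
proof (rule antisym)
  show "warmth G \<le> enat (Max {d. warm d G})"
    unfolding warmth_def by (rule SUP_least) (use assms in auto)
  have "Max {d. warm d G} \<in> {d. warm d G}"
    using assms warm_2[of G] by (intro Max_in) auto
  then show "enat (Max {d. warm d G}) \<le> warmth G"
    unfolding warmth_def by (rule SUP_upper)
qed

end

theory Submission
  imports Defs "HOL-Real_Asymp.Real_Asymp"
begin

text \<open>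
  Let \<open>b\<close> be the number of children. Given a homomorphism \<open>\<phi>\<close> from the tree, prescribe its
  values at depth \<open>3\<close> only, and propagate towards the root the sets of values compatible with them.
  At depth \<open>2\<close> these are common neighbourhoods of at most \<open>b < (1 - \<epsilon>) log\<^sub>2 n + 1\<close> vertices, which
  in \<open>G(n, 1/2)\<close> exceed every power of \<open>log n\<close>. Since any two disjoint sets of about
  \<open>3 log\<^sub>2 n\<close> vertices are joined by an edge, at depth \<open>1\<close> all but \<open>O(log\<^sup>2 n)\<close> vertices are
  compatible, fewer exceptions than the minimum degree; so at the root every vertex is.
\<close>

section \<open>Warmth from expansion: the deterministic argument\<close>

text \<open>Prescribing depth \<open>3\<close> leaves at least \<open>m\<close> admissible values at
  each vertex of depth \<open>2\<close>. A set of that size has a neighbour in all but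
  \<open>2 * s\<close> vertices, so after intersecting over \<open>b\<close> children at most
  \<open>b * (2 * s)\<close> values are excluded at depth \<open>1\<close>. This is less than
  \<open>m\<close>, a lower bound for every degree, so no value is excluded at the root. The shift
  by \<open>2\<close> is the one in \<open>warm\<close>, which speaks of the tree with
  \<open>d - 2\<close> children.\<close>

lemma warm_if_expanding:
  fixes G :: "'a graph"
  assumes fin: "finite (verts G)" and b: "b > 0" "b \<le> card (verts G)"
    and nbrs: "\<And>W. W \<subseteq> verts G \<Longrightarrow> card W = b \<Longrightarrow>
      m \<le> card {x \<in> verts G. \<forall>w\<in>W. {x, w} \<in> edges G}"
    and edge: "\<And>S T. S \<subseteq> verts G \<Longrightarrow> T \<subseteq> verts G \<Longrightarrow> S \<inter> T = {} \<Longrightarrow> card S = s \<Longrightarrow> card T = s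
      \<Longrightarrow> \<exists>x\<in>S. \<exists>y\<in>T. {x, y} \<in> edges G"
    and m: "s \<le> m" "b * (2 * s) < m"
  shows "warm (b + 2) G"
proof -
  define V where "V = verts G"
  define E where "E = edges G"
  \<comment> \<open>Enlarging \<open>W\<close> to exactly \<open>b\<close> vertices only shrinks its
    common neighbourhood. Smaller sets occur because siblings may share a value under
    \<open>\<phi>\<close>, and because the degree of a single vertex is needed at the root.\<close>
  have nbrs': "m \<le> card {x \<in> V. \<forall>w\<in>W. {x, w} \<in> E}" if W: "W \<subseteq> V" "card W \<le> b" for W
  proof -
    obtain W' where W': "W \<subseteq> W'" "W' \<subseteq> V" "card W' = b"
      using exists_subset_between[of W b V] W b(2) fin unfolding V_def by metis
    have "m \<le> card {x \<in> V. \<forall>w\<in>W'. {x, w} \<in> E}"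
      using nbrs W' by (simp add: V_def E_def)
    also have "\<dots> \<le> card {x \<in> V. \<forall>w\<in>W. {x, w} \<in> E}"
      using fin W'(1) by (intro card_mono) (auto simp: V_def)
    finally show ?thesis .
  qed
  \<comment> \<open>Half of the \<open>2 * s\<close> pays for the \<open>s\<close>-set
    \<open>S'\<close> chosen in \<open>S\<close>, removed to have disjoint sets; the other half
    bounds the remaining exceptions, \<open>s\<close> of which would contradict the edge
    hypothesis.\<close>
  have non_nbrs: "card {x \<in> V. \<not> (\<exists>y\<in>S. {x, y} \<in> E)} \<le> 2 * s" if S: "S \<subseteq> V" "m \<le> card S" for S
  proof -
    obtain S' where S': "S' \<subseteq> S" "card S' = s"
      using S m by (meson obtain_subset_with_card_n order_trans)
    define U where "U = {x \<in> V. \<not> (\<exists>y\<in>S. {x, y} \<in> E)} - S'"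
    have "card U < s"
    proof (rule ccontr)
      assume "\<not> card U < s"
      then obtain T where T: "T \<subseteq> U" "card T = s"
        by (meson obtain_subset_with_card_n not_less)
      have "\<exists>x\<in>T. \<exists>y\<in>S'. {x, y} \<in> E"
        unfolding E_def using T S' S by (intro edge) (auto simp: U_def V_def)
      then show False using T S' by (auto simp: U_def)
    qed
    have finS': "finite S'" using S S' fin V_def by (meson finite_subset)
    have finU: "finite U" using fin by (simp add: U_def V_def)
    have "card {x \<in> V. \<not> (\<exists>y\<in>S. {x, y} \<in> E)} \<le> card (U \<union> S')"
      using finS' finU by (intro card_mono) (auto simp: U_def)
    also have "\<dots> \<le> card U + card S'" by (rule card_Un_le)
    finally show ?thesis using \<open>card U < s\<close> S' by simp
  qed
  have "\<not> cold b G \<phi>" if \<phi>: "\<phi> \<in> graph_hom (tree b) G" for \<phi>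
  proof
    have \<phi>V: "\<phi> v \<in> V" if "v \<in> lists {..<b}" for v
      using \<phi> that by (auto simp: graph_hom_def tree_def V_def)
    have \<phi>E: "{\<phi> v, \<phi> (i # v)} \<in> E" if "v \<in> lists {..<b}" "i < b" for v i
    proof -
      have "{v, i # v} \<in> edges (tree b)" using that by (auto simp: tree_def)
      then have "\<phi> ` {v, i # v} \<in> E" using \<phi> by (auto simp: graph_hom_def E_def)
      then show ?thesis by simp
    qed
    \<comment> \<open>\<open>S1 u\<close> collects the values possible at \<open>u\<close> when its
      children keep their values under \<open>\<phi>\<close> (used at depth \<open>2\<close>);
      \<open>S2 u\<close> collects those having, for every child, a neighbour in that child's
      \<open>S1\<close> (used at depth \<open>1\<close>).\<close>
    define S1 where "S1 u = {x \<in> V. \<forall>w \<in> (\<lambda>i. \<phi> (i # u)) ` {..<b}. {x, w} \<in> E}" for u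
    define S2 where "S2 u = {x \<in> V. \<forall>i<b. \<exists>y\<in>S1 (i # u). {x, y} \<in> E}" for u
    have S1: "m \<le> card (S1 u)" if "u \<in> lists {..<b}" for u
      unfolding S1_def
      by (rule nbrs') (use that card_image_le[of "{..<b}"] in \<open>auto intro!: \<phi>V\<close>)
    have S2: "card (V - S2 u) \<le> b * (2 * s)" if u: "u \<in> lists {..<b}" for u
    proof -
      have "V - S2 u = (\<Union>i<b. {x \<in> V. \<not> (\<exists>y\<in>S1 (i # u). {x, y} \<in> E)})"
        by (auto simp: S2_def)
      also have "card \<dots> \<le> (\<Sum>i<b. card {x \<in> V. \<not> (\<exists>y\<in>S1 (i # u). {x, y} \<in> E)})"
        by (rule card_UN_le) simp
      also have "\<dots> \<le> (\<Sum>i<b. 2 * s)"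
        by (intro sum_mono non_nbrs S1) (use u in \<open>auto simp: S1_def\<close>)
      finally show ?thesis by simp
    qed
    have vt: "verts (tree b) = lists {..<b}" by (simp add: tree_def)
    assume "cold b G \<phi>"
    then obtain a where a: "a \<in> V" and no: "\<And>\<psi>. \<psi> \<in> graph_hom (tree b) G \<Longrightarrow>
        (\<forall>v \<in> lists {..<b}. length v = 3 \<longrightarrow> \<psi> v = \<phi> v) \<Longrightarrow> \<psi> [] \<noteq> a"
      unfolding cold_def V_def vt by metis
    \<comment> \<open>Otherwise all neighbours of \<open>a\<close>, at least \<open>m\<close> of
      them, would lie among the fewer than \<open>m\<close> vertices outside
      \<open>S2 [i]\<close>.\<close>
    have "\<exists>x\<in>S2 [i]. {a, x} \<in> E" if "i < b" for i
    proof (rule ccontr)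
      assume *: "\<not> ?thesis"
      have "m \<le> card {x \<in> V. \<forall>w\<in>{a}. {x, w} \<in> E}" by (rule nbrs') (use a b in auto)
      also have "\<dots> \<le> card (V - S2 [i])"
        using * fin by (intro card_mono) (auto simp: V_def insert_commute)
      also have "\<dots> \<le> b * (2 * s)" by (rule S2) (use that in auto)
      finally show False using m by simp
    qed
    then obtain f where f: "\<And>i. i < b \<Longrightarrow> f i \<in> S2 [i] \<and> {a, f i} \<in> E" by metis
    \<comment> \<open>Words list the last step first: \<open>[j, i]\<close> is child
      \<open>j\<close> of the vertex \<open>[i]\<close>, so its value must be adjacent to
      \<open>f i\<close>.\<close>
    define g where "g j i = (SOME y. y \<in> S1 [j, i] \<and> {f i, y} \<in> E)" for j i
    have g: "g j i \<in> S1 [j, i] \<and> {f i, g j i} \<in> E" if "i < b" "j < b" for i j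
      unfolding g_def by (rule someI_ex) (use f[OF that(1)] that(2) in \<open>auto simp: S2_def\<close>)
    \<comment> \<open>Only depths \<open>0\<close>, \<open>1\<close> and \<open>2\<close> are
      rebuilt; from depth \<open>3\<close> on \<open>\<phi>\<close> is kept. The value
      \<open>undefined\<close> off the tree is forced by the extensional function space in
      \<open>graph_hom\<close>.\<close>
    define \<psi> where "\<psi> v = (if v \<notin> lists {..<b} then undefined else
      case v of [] \<Rightarrow> a | [i] \<Rightarrow> f i | [j, i] \<Rightarrow> g j i | _ \<Rightarrow> \<phi> v)" for v
    have fV: "f i \<in> V" if "i < b" for i
      using f[OF that] by (simp add: S2_def)
    have gV: "g j i \<in> V" if "i < b" "j < b" for i j
      using g[OF that] by (simp add: S1_def)
    have \<psi>V: "\<psi> v \<in> V" if "v \<in> lists {..<b}" for v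
      using that a by (auto simp: \<psi>_def fV gV split: list.split intro!: \<phi>V)
    have \<psi>E: "{\<psi> v, \<psi> (i # v)} \<in> E" if v: "v \<in> lists {..<b}" and i: "i < b" for v i
    proof -
      have "{g j k, \<phi> [i, j, k]} \<in> E" if "j < b" "k < b" for j k
        using g[OF that(2,1)] i by (simp add: S1_def)
      then show ?thesis
        using v i \<phi>E[OF v i] by (auto simp: \<psi>_def f g split: list.split)
    qed
    have "\<psi> v = undefined" if "v \<notin> lists {..<b}" for v
      using that by (simp add: \<psi>_def)
    with \<psi>V have "\<psi> \<in> verts (tree b) \<rightarrow>\<^sub>E verts G"
      unfolding vt V_def by (intro PiE_I)
    moreover have "\<psi> ` e \<in> E" if "e \<in> edges (tree b)" for e
    proof -
      obtain v i where "e = {v, i # v}" "v \<in> lists {..<b}" "i < b"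
        using \<open>e \<in> edges (tree b)\<close> unfolding tree_def graph.simps by blast
      then show ?thesis using \<psi>E[of v i] by simp
    qed
    ultimately have "\<psi> \<in> graph_hom (tree b) G"
      by (simp add: graph_hom_def E_def)
    moreover have "\<psi> v = \<phi> v" if "v \<in> lists {..<b}" "length v = 3" for v
      using that by (auto simp: \<psi>_def numeral_3_eq_3 length_Suc_conv)
    ultimately show False using no[of \<psi>] by (simp add: \<psi>_def)
  qed
  then show ?thesis by (auto simp: warm_def)
qed

section \<open>Independence of disjoint blocks of Bernoulli variables\<close>

lemma prob_pair_pmf_Times:
  "measure_pmf.prob (pair_pmf M N) (A \<times> B) = measure_pmf.prob M A * measure_pmf.prob N B"
proof -
  \<comment> \<open>Cutting down to the supports makes both factors countable without changing any
    probability.\<close>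
  have "measure_pmf.prob (pair_pmf M N) (A \<times> B) =
      measure_pmf.prob (pair_pmf M N) ((A \<inter> set_pmf M) \<times> (B \<inter> set_pmf N))"
    by (subst measure_Int_set_pmf[symmetric]) (auto intro!: arg_cong[where f = "measure _"])
  also have "\<dots> = measure_pmf.prob M A * measure_pmf.prob N B"
    by (subst measure_pmf_prob_product) (auto simp: measure_Int_set_pmf)
  finally show ?thesis .
qed

lemma prob_bernoulli_some_absent:
  assumes "finite A" "0 \<le> p" "p \<le> 1"
  shows "measure_pmf.prob (Pi_pmf A False (\<lambda>_. bernoulli_pmf p)) {f. \<exists>e\<in>A. \<not> f e} = 1 - p ^ card A"
proof -
  have "{f. \<exists>e\<in>A. \<not> f e} = UNIV - Pi A (\<lambda>_. {True})" by (auto simp: Pi_def)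
  then show ?thesis
    using assms measure_pmf.prob_compl[of "Pi A (\<lambda>_. {True})" "Pi_pmf A False (\<lambda>_. bernoulli_pmf p)"]
    by (simp add: measure_Pi_pmf_Pi measure_pmf_single)
qed

text \<open>Disjoint blocks depend on disjoint sets of coordinates and are therefore independent.
  The induction splits off one block \<open>E j\<close>, writing the product measure on
  \<open>A\<close> as a pair of product measures on \<open>E j\<close> and \<open>A - E j\<close>;
  the other blocks live on \<open>A - E j\<close>, hence the generalization over \<open>A\<close>.
  Blocks will be stars of edges in one application and single edges in another.\<close>

lemma prob_bernoulli_no_full_block:
  assumes "finite J" "finite A" "disjoint_family_on E J" "\<And>j. j \<in> J \<Longrightarrow> E j \<subseteq> A" "0 \<le> p" "p \<le> 1"
  shows "measure_pmf.prob (Pi_pmf A False (\<lambda>_. bernoulli_pmf p)) {f. \<forall>j\<in>J. \<exists>e\<in>E j. \<not> f e}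
    = (\<Prod>j\<in>J. 1 - p ^ card (E j))"
  using assms
proof (induction J arbitrary: A rule: finite_induct)
  case (insert j J)
  let ?P = "\<lambda>A. Pi_pmf A False (\<lambda>_. bernoulli_pmf p)"
  have fin: "finite (E j)" using insert.prems by (meson finite_subset insertI1)
  have disj: "E i \<inter> E j = {}" if "i \<in> J" for i
    using insert.prems(2) insert.hyps that by (auto simp: disjoint_family_on_def)
  have notin: "e \<notin> E j" if "i \<in> J" "e \<in> E i" for i e
    using disj that by blast
  have "?P A = ?P (E j \<union> (A - E j))"
    using insert.prems(3)[of j] by (simp add: Un_absorb1)
  also have "\<dots> = map_pmf (\<lambda>(f, g) x. if x \<in> E j then f x else g x) (pair_pmf (?P (E j)) (?P (A - E j)))"
    using fin insert.prems by (intro Pi_pmf_union) auto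
  finally have "measure_pmf.prob (?P A) {f. \<forall>i\<in>insert j J. \<exists>e\<in>E i. \<not> f e} =
      measure_pmf.prob (pair_pmf (?P (E j)) (?P (A - E j)))
        ((\<lambda>(f, g) x. if x \<in> E j then f x else g x) -` {f. \<forall>i\<in>insert j J. \<exists>e\<in>E i. \<not> f e})"
    by simp
  also have "(\<lambda>(f, g) x. if x \<in> E j then f x else g x) -` {f. \<forall>i\<in>insert j J. \<exists>e\<in>E i. \<not> f e} =
      {f. \<exists>e\<in>E j. \<not> f e} \<times> {f. \<forall>i\<in>J. \<exists>e\<in>E i. \<not> f e}"
    unfolding set_eq_iff split_paired_all by (simp add: notin)
  also have "measure_pmf.prob (pair_pmf (?P (E j)) (?P (A - E j))) \<dots> =
      (1 - p ^ card (E j)) * (\<Prod>i\<in>J. 1 - p ^ card (E i))"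
    unfolding prob_pair_pmf_Times
  proof (intro arg_cong2[where f = "(*)"])
    show "measure_pmf.prob (?P (E j)) {f. \<exists>e\<in>E j. \<not> f e} = 1 - p ^ card (E j)"
      using fin insert.prems by (intro prob_bernoulli_some_absent)
    show "measure_pmf.prob (?P (A - E j)) {f. \<forall>i\<in>J. \<exists>e\<in>E i. \<not> f e} = (\<Prod>i\<in>J. 1 - p ^ card (E i))"
      using insert.prems disj
      by (intro insert.IH) (auto simp: disjoint_family_on_def disjoint_iff)
  qed
  finally show ?case using insert.hyps by simp
qed auto

section \<open>Union bounds for the two bad events in the random graph\<close>

lemma card_subsets_le_power:
  assumes "finite A"
  shows "card {B. B \<subseteq> A \<and> card B = k} \<le> card A ^ k"
proof (cases "k \<le> card A")
  case True
  then show ?thesis using assms by (simp add: n_subsets binomial_le_pow)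
qed (use assms in \<open>simp add: n_subsets binomial_eq_0\<close>)

lemma prob_random_graph:
  "measure_pmf.prob (random_graph n p) X =
    measure_pmf.prob (Pi_pmf (all_edges {..<n}) False (\<lambda>_. bernoulli_pmf p))
      {f. \<lparr>verts = {..<n}, edges = {e \<in> all_edges {..<n}. f e}\<rparr> \<in> X}"
  by (simp add: random_graph_def vimage_def)

lemma finite_all_edges: "finite A \<Longrightarrow> finite (all_edges A)"
  by (simp add: all_edges_def)

lemma doubleton_in_all_edges_iff: "{x, y} \<in> all_edges A \<longleftrightarrow> x \<in> A \<and> y \<in> A \<and> x \<noteq> y"
  by (auto simp: all_edges_def card_insert_if)

text \<open>Each \<open>x\<close> outside \<open>W\<close> and \<open>M\<close> fails to be joined
  to all of \<open>W\<close> with probability \<open>1 - (1/2) ^ b\<close>, independently of the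
  others, and at least \<open>n - (b + m)\<close> such \<open>x\<close> remain. Leaving out
  \<open>W\<close> makes the stars from \<open>x\<close> to \<open>W\<close> consist of genuine
  edges and be pairwise disjoint.\<close>

lemma prob_no_common_nbr_outside:
  assumes W: "W \<subseteq> {..<n}" "card W = b" and M: "M \<subseteq> {..<n}" "card M = m"
  shows "measure_pmf.prob (random_graph n (1/2))
      {G. \<forall>x\<in>{..<n} - W - M. \<exists>w\<in>W. {x, w} \<notin> edges G} \<le> (1 - (1/2) ^ b) ^ (n - (b + m))"
proof -
  define J where "J = {..<n} - W - M"
  define E where "E x = (\<lambda>w. {x, w}) ` W" for x
  have finW: "finite W" using W finite_subset by blast
  have E: "card (E x) = b" for x
    unfolding E_def using W by (subst card_image) (auto simp: inj_on_def doubleton_eq_iff)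
  have edges: "{x, w} \<in> all_edges {..<n}" if "x \<in> J" "w \<in> W" for x w
    using that W by (auto simp: J_def doubleton_in_all_edges_iff)
  have "measure_pmf.prob (random_graph n (1/2)) {G. \<forall>x\<in>J. \<exists>w\<in>W. {x, w} \<notin> edges G} =
      measure_pmf.prob (Pi_pmf (all_edges {..<n}) False (\<lambda>_. bernoulli_pmf (1/2)))
        {f. \<forall>x\<in>J. \<exists>e\<in>E x. \<not> f e}"
    unfolding prob_random_graph using edges by (intro arg_cong[where f = "measure _"]) (auto simp: E_def)
  also have "\<dots> = (\<Prod>x\<in>J. 1 - (1/2) ^ card (E x))"
  proof (rule prob_bernoulli_no_full_block)
    show "disjoint_family_on E J"
      by (auto simp: disjoint_family_on_def E_def J_def doubleton_eq_iff)
  qed (use edges in \<open>auto simp: E_def J_def finite_all_edges\<close>)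
  also have "\<dots> = (1 - (1/2) ^ b) ^ card J" by (simp add: E)
  also have "\<dots> \<le> (1 - (1/2) ^ b) ^ (n - (b + m))"
  proof (rule power_decreasing)
    have "n - b = card ({..<n} - W)" using W finW by (simp add: card_Diff_subset)
    moreover have "card ({..<n} - W) - card M \<le> card J"
      unfolding J_def using M by (intro diff_card_le_card_Diff finite_subset[of M "{..<n}"]) auto
    ultimately show "n - (b + m) \<le> card J" using M by simp
  qed (auto simp: power_le_one)
  finally show ?thesis by (simp add: J_def)
qed

text \<open>Fewer than \<open>m\<close> common neighbours fit into some \<open>M\<close> with
  exactly \<open>m\<close> elements, and then no vertex outside \<open>W\<close> and
  \<open>M\<close> is joined to all of \<open>W\<close>. The union bound runs over at most
  \<open>n ^ b * n ^ m\<close> pairs \<open>(W, M)\<close>.\<close>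

lemma prob_few_common_nbrs:
  assumes "m \<le> n"
  shows "measure_pmf.prob (random_graph n (1/2))
      {G. \<exists>W\<subseteq>{..<n}. card W = b \<and> card {x \<in> {..<n}. \<forall>w\<in>W. {x, w} \<in> edges G} < m}
    \<le> real n ^ (b + m) * (1 - (1/2) ^ b) ^ (n - (b + m))" (is "measure_pmf.prob ?R ?X \<le> _")
proof -
  let ?I = "{W. W \<subseteq> {..<n} \<and> card W = b} \<times> {M. M \<subseteq> {..<n} \<and> card M = m}"
  let ?Y = "\<lambda>(W, M). {G. \<forall>x\<in>{..<n} - W - M. \<exists>w\<in>W. {x, w} \<notin> edges G}"
  have finI: "finite ?I" by simp
  have "?X \<subseteq> (\<Union>i\<in>?I. ?Y i)"
  proof
    fix G assume "G \<in> ?X"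
    then obtain W where W: "W \<subseteq> {..<n}" "card W = b"
      and less: "card {x \<in> {..<n}. \<forall>w\<in>W. {x, w} \<in> edges G} < m" by auto
    obtain M where "{x \<in> {..<n}. \<forall>w\<in>W. {x, w} \<in> edges G} \<subseteq> M" "M \<subseteq> {..<n}" "card M = m"
      using exists_subset_between[of "{x \<in> {..<n}. \<forall>w\<in>W. {x, w} \<in> edges G}" m "{..<n}"] less assms by auto
    then show "G \<in> (\<Union>i\<in>?I. ?Y i)" using W by (intro UN_I[of "(W, M)"]) auto
  qed
  then have "measure_pmf.prob ?R ?X \<le> measure_pmf.prob ?R (\<Union>i\<in>?I. ?Y i)"
    by (intro measure_pmf.finite_measure_mono) auto
  also have "\<dots> \<le> (\<Sum>i\<in>?I. measure_pmf.prob ?R (?Y i))"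
    by (intro measure_pmf.finite_measure_subadditive_finite finI) auto
  also have "\<dots> \<le> (\<Sum>i\<in>?I. (1 - (1/2) ^ b) ^ (n - (b + m)))"
    by (intro sum_mono) (auto intro!: prob_no_common_nbr_outside)
  also have "\<dots> = real (card ?I) * (1 - (1/2) ^ b) ^ (n - (b + m))" by simp
  also have "\<dots> \<le> real n ^ (b + m) * (1 - (1/2) ^ b) ^ (n - (b + m))"
  proof (rule mult_right_mono)
    have "card ?I \<le> n ^ b * n ^ m"
      unfolding card_cartesian_product
      using card_subsets_le_power[of "{..<n}"] by (intro mult_mono) auto
    then show "real (card ?I) \<le> real n ^ (b + m)"
      unfolding power_add of_nat_power[symmetric] of_nat_mult[symmetric] by (rule of_nat_mono)
  qed (auto simp: power_le_one)
  finally show ?thesis .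
qed

text \<open>As \<open>S\<close> and \<open>T\<close> are disjoint, the \<open>s * s\<close> pairs
  are distinct possible edges, each forming a block of its own.\<close>

lemma prob_no_edge_between:
  assumes S: "S \<subseteq> {..<n}" "card S = s" and T: "T \<subseteq> {..<n}" "card T = s" and "S \<inter> T = {}"
  shows "measure_pmf.prob (random_graph n (1/2)) {G. \<forall>x\<in>S. \<forall>y\<in>T. {x, y} \<notin> edges G} = (1/2) ^ (s * s)"
proof -
  have edges: "{x, y} \<in> all_edges {..<n}" if "x \<in> S" "y \<in> T" for x y
    using that assms by (auto simp: doubleton_in_all_edges_iff)
  have fin: "finite S" "finite T" using S T finite_subset by blast+
  have "measure_pmf.prob (random_graph n (1/2)) {G. \<forall>x\<in>S. \<forall>y\<in>T. {x, y} \<notin> edges G} =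
      measure_pmf.prob (Pi_pmf (all_edges {..<n}) False (\<lambda>_. bernoulli_pmf (1/2)))
        {f. \<forall>j\<in>S \<times> T. \<exists>e\<in>{{fst j, snd j}}. \<not> f e}"
    unfolding prob_random_graph using edges by (intro arg_cong[where f = "measure _"]) auto
  also have "\<dots> = (\<Prod>j\<in>S \<times> T. 1 - (1/2) ^ card {{fst j, snd j}})"
    by (rule prob_bernoulli_no_full_block)
      (use assms edges fin in \<open>auto simp: disjoint_family_on_def doubleton_eq_iff finite_all_edges\<close>)
  finally show ?thesis using S T by (simp add: card_cartesian_product)
qed

lemma prob_some_no_edge_between:
  "measure_pmf.prob (random_graph n (1/2))
      {G. \<exists>S T. S \<subseteq> {..<n} \<and> T \<subseteq> {..<n} \<and> S \<inter> T = {} \<and> card S = s \<and> card T = s \<and>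
        (\<forall>x\<in>S. \<forall>y\<in>T. {x, y} \<notin> edges G)}
    \<le> real n ^ (2 * s) * (1/2) ^ (s * s)" (is "measure_pmf.prob ?R ?X \<le> _")
proof -
  let ?K = "{S. S \<subseteq> {..<n} \<and> card S = s}"
  let ?I = "{(S, T) \<in> ?K \<times> ?K. S \<inter> T = {}}"
  let ?Y = "\<lambda>(S, T). {G. \<forall>x\<in>S. \<forall>y\<in>T. {x, y} \<notin> edges G}"
  have finI: "finite ?I" by (rule finite_subset[of _ "?K \<times> ?K"]) auto
  have "?X = (\<Union>i\<in>?I. ?Y i)" by auto
  then have "measure_pmf.prob ?R ?X \<le> (\<Sum>i\<in>?I. measure_pmf.prob ?R (?Y i))"
    using measure_pmf.finite_measure_subadditive_finite[OF finI, of ?Y ?R] by simp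
  also have "\<dots> = (\<Sum>i\<in>?I. (1/2) ^ (s * s))"
    by (intro sum.cong) (auto intro!: prob_no_edge_between)
  also have "\<dots> = real (card ?I) * (1/2) ^ (s * s)" by simp
  also have "\<dots> \<le> real n ^ (2 * s) * (1/2) ^ (s * s)"
  proof (rule mult_right_mono)
    have "card ?I \<le> card (?K \<times> ?K)" by (intro card_mono) auto
    also have "\<dots> \<le> n ^ s * n ^ s"
      unfolding card_cartesian_product
      using card_subsets_le_power[of "{..<n}" s] by (intro mult_mono) auto
    finally show "real (card ?I) \<le> real n ^ (2 * s)"
      unfolding mult_2 power_add of_nat_power[symmetric] of_nat_mult[symmetric] by (rule of_nat_mono)
  qed auto
  finally show ?thesis .
qed

lemma prob_warmth_ge:
  assumes "0 < b" "b \<le> n" "m \<le> n" "s \<le> m" "b * (2 * s) < m"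
  shows "1 - real n ^ (b + m) * (1 - (1/2) ^ b) ^ (n - (b + m)) - real n ^ (2 * s) * (1/2) ^ (s * s)
    \<le> measure_pmf.prob (random_graph n (1/2)) {G. enat (b + 2) \<le> warmth G}"
proof -
  let ?R = "random_graph n (1/2)"
  define A where "A = {G :: nat graph. \<exists>W\<subseteq>{..<n}. card W = b \<and>
    card {x \<in> {..<n}. \<forall>w\<in>W. {x, w} \<in> edges G} < m}"
  define B where "B = {G :: nat graph. \<exists>S T. S \<subseteq> {..<n} \<and> T \<subseteq> {..<n} \<and> S \<inter> T = {} \<and> card S = s \<and> card T = s \<and>
    (\<forall>x\<in>S. \<forall>y\<in>T. {x, y} \<notin> edges G)}"
  have A: "measure_pmf.prob ?R A \<le> real n ^ (b + m) * (1 - (1/2) ^ b) ^ (n - (b + m))"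
    unfolding A_def using assms by (intro prob_few_common_nbrs)
  have B: "measure_pmf.prob ?R B \<le> real n ^ (2 * s) * (1/2) ^ (s * s)"
    unfolding B_def by (rule prob_some_no_edge_between)
  have warm: "enat (b + 2) \<le> warmth G" if "G \<in> set_pmf ?R" "G \<notin> A" "G \<notin> B" for G
  proof -
    have V: "verts G = {..<n}" using that(1) by (auto simp: random_graph_def)
    have "warm (b + 2) G"
    proof (rule warm_if_expanding)
      show "m \<le> card {x \<in> verts G. \<forall>w\<in>W. {x, w} \<in> edges G}"
        if "W \<subseteq> verts G" "card W = b" for W
        using \<open>G \<notin> A\<close> that unfolding A_def V by (auto simp: not_less)
      show "\<exists>x\<in>S. \<exists>y\<in>T. {x, y} \<in> edges G"
        if "S \<subseteq> verts G" "T \<subseteq> verts G" "S \<inter> T = {}" "card S = s" "card T = s" for S T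
        using \<open>G \<notin> B\<close> that unfolding B_def V by blast
    qed (use assms in \<open>simp_all add: V\<close>)
    then show ?thesis unfolding warmth_def by (intro SUP_upper) simp
  qed
  have "1 - measure_pmf.prob ?R A - measure_pmf.prob ?R B \<le> 1 - measure_pmf.prob ?R (A \<union> B)"
    using measure_Un_le[of A "measure_pmf ?R" B] by simp
  also have "\<dots> = measure_pmf.prob ?R (- (A \<union> B))"
    using measure_pmf.prob_compl[of "A \<union> B" ?R] by (simp add: Compl_eq_Diff_UNIV)
  also have "\<dots> \<le> measure_pmf.prob ?R {G. enat (b + 2) \<le> warmth G}"
    \<comment> \<open>The inclusion is claimed only on the support, where the vertex set is known to
      be \<open>{..<n}\<close>.\<close>
    by (intro measure_pmf.finite_measure_mono_AE) (use warm in \<open>auto simp: AE_measure_pmf_iff\<close>)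
  finally show ?thesis using A B by linarith
qed

section \<open>Estimates for the error terms and choice of parameters\<close>

text \<open>Uses \<open>1 - x \<le> exp (- x)\<close> with \<open>x = (1/2) ^ b\<close>, which is at
  least half of \<open>n powr (- \<beta>)\<close>; the half comes from rounding \<open>b\<close> up.
  Replacing \<open>k\<close> by the real bound \<open>q\<close> gives an expression free of integer
  rounding, suited to taking limits.\<close>

lemma few_common_nbrs_bound:
  fixes n b k :: nat and q \<beta> :: real
  assumes "2 \<le> n" "real k \<le> q" "q \<le> n" "real b \<le> \<beta> * log 2 n + 1"
  shows "real n ^ k * (1 - (1/2) ^ b) ^ (n - k) \<le> exp (q * ln n - (n - q) * n powr (- \<beta>) / 2)"
proof -
  have "2 ^ b = 2 powr real b" by (simp add: powr_realpow)
  also have "\<dots> \<le> 2 powr (\<beta> * log 2 n + 1)" using assms by (intro powr_mono) auto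
  also have "\<dots> = 2 * n powr \<beta>"
  proof -
    have "2 powr (\<beta> * log 2 n) = (2 powr log 2 n) powr \<beta>"
      by (simp only: powr_powr mult.commute)
    then show ?thesis using assms(1) by (simp add: powr_add)
  qed
  finally have "(1/2) ^ b \<ge> n powr (- \<beta>) / 2"
    using assms(1) by (simp add: powr_minus field_simps)
  have "1 - (1/2 :: real) ^ b \<le> exp (- ((1/2) ^ b))"
    using exp_ge_add_one_self[of "- ((1/2 :: real) ^ b)"] by simp
  then have "(1 - (1/2 :: real) ^ b) ^ (n - k) \<le> exp (- ((1/2) ^ b)) ^ (n - k)"
    by (intro power_mono) (auto simp: power_le_one)
  also have "\<dots> = exp (- (real (n - k) * (1/2) ^ b))"
    by (simp add: exp_of_nat_mult[symmetric])
  also have "real (n - k) * (1/2) ^ b \<ge> (n - q) * (n powr (- \<beta>) / 2)"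
    using assms \<open>(1/2) ^ b \<ge> n powr (- \<beta>) / 2\<close> by (intro mult_mono) auto
  then have "exp (- (real (n - k) * (1/2) ^ b)) \<le> exp (- ((n - q) * n powr (- \<beta>) / 2))"
    by simp
  finally have *: "(1 - (1/2 :: real) ^ b) ^ (n - k) \<le> exp (- ((n - q) * n powr (- \<beta>) / 2))" .
  have "real n ^ k = exp (real k * ln n)"
    using assms(1) by (simp add: exp_of_nat_mult)
  also have "\<dots> \<le> exp (q * ln n)"
    using assms by (auto intro!: mult_right_mono)
  finally have "real n ^ k * (1 - (1/2) ^ b) ^ (n - k)
      \<le> exp (q * ln n) * exp (- ((n - q) * n powr (- \<beta>) / 2))"
    using * by (intro mult_mono) (auto simp: power_le_one)
  then show ?thesis by (simp add: exp_add[symmetric])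
qed

text \<open>With \<open>L = log 2 n\<close> the left side is \<open>2\<close> to the power
  \<open>2 * s * L - s * s\<close>. Since \<open>s \<ge> 3 * L\<close>, the exponent is at most
  \<open>- s * L\<close>, hence at most \<open>- L\<close>.\<close>

lemma no_edge_between_bound:
  fixes n s :: nat
  assumes "2 \<le> n" "3 * log 2 n \<le> s"
  shows "real n ^ (2 * s) * (1/2) ^ (s * s) \<le> 1 / n"
proof -
  have l: "1 \<le> log 2 n" using assms by (simp add: le_log_iff)
  have "real n ^ (2 * s) = real n powr real (2 * s)"
    using assms by (intro powr_realpow[symmetric]) auto
  also have "\<dots> = (2 powr log 2 n) powr (2 * s)" using assms by simp
  also have "\<dots> = 2 powr (2 * s * log 2 n)" by (simp only: powr_powr mult.commute)
  finally have "real n ^ (2 * s) = 2 powr (2 * s * log 2 n)" .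
  moreover have "(1/2 :: real) ^ (s * s) = 2 powr (- (real s * real s))"
  proof -
    have "2 powr (real s * real s) = (2 :: real) ^ (s * s)"
      using powr_realpow[of 2 "s * s"] by simp
    then show ?thesis by (simp add: powr_minus power_one_over inverse_eq_divide)
  qed
  ultimately have "real n ^ (2 * s) * (1/2) ^ (s * s) = 2 powr (2 * s * log 2 n - real s * real s)"
    by (simp add: powr_add[symmetric])
  also have "\<dots> \<le> 2 powr (- log 2 n)"
  proof (rule powr_mono)
    have "3 * log 2 n * s \<le> real s * s" using assms by (intro mult_right_mono) auto
    moreover have "1 \<le> real s" using assms l by linarith
    then have "1 * log 2 n \<le> s * log 2 n" using l by (intro mult_right_mono) auto
    ultimately show "2 * s * log 2 n - real s * real s \<le> - log 2 n"
      by (simp add: algebra_simps)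
  qed auto
  also have "\<dots> = 1 / n" using assms by (simp add: powr_minus divide_simps)
  finally show ?thesis .
qed

theorem theorem3p4:
  fixes \<delta> :: real
  assumes "\<delta> > 0"
  shows "(\<lambda>n. measure_pmf.prob (random_graph n (1/2))
            {G. ereal_of_enat (warmth G) \<ge> ereal ((1 - \<delta>) * log 2 (real n))})
         \<longlonglongrightarrow> 1"
proof -
  \<comment> \<open>The claim for a smaller constant is stronger; staying below \<open>1\<close>
    keeps \<open>b\<close> positive even when \<open>\<delta> \<ge> 1\<close>.\<close>
  define \<epsilon> where "\<epsilon> = min \<delta> (1/2)"
  have \<epsilon>: "0 < \<epsilon>" "\<epsilon> \<le> \<delta>" "\<epsilon> < 1" using assms by (auto simp: \<epsilon>_def)
  \<comment> \<open>An upper bound for \<open>b + m\<close>: \<open>3 * log 2 n + 1\<close> bounds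
    \<open>s\<close> and thereby \<open>b\<close>, and the square term bounds
    \<open>m = 4 * s\<^sup>2\<close>.\<close>
  define q where "q n = 3 * log 2 n + 1 + 4 * (3 * log 2 n + 1)\<^sup>2" for n :: nat
  define t where "t n = exp (q n * ln n - (n - q n) * n powr (- (1 - \<epsilon>)) / 2)" for n :: nat
  \<comment> \<open>The positive part of the exponent is polylogarithmic, while the negative part
    grows like \<open>n powr \<epsilon>\<close>.\<close>
  have "t \<longlonglongrightarrow> 0"
    unfolding t_def q_def using \<epsilon> by real_asymp
  then have lim: "(\<lambda>n. 1 - t n - 1 / real n) \<longlonglongrightarrow> 1"
    using tendsto_diff[OF tendsto_diff[OF tendsto_const[of 1] \<open>t \<longlonglongrightarrow> 0\<close>] lim_1_over_n] by simp
  have "eventually (\<lambda>n. q n \<le> n) sequentially"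
    unfolding q_def by real_asymp
  then have "eventually (\<lambda>n. 1 - t n - 1 / real n \<le> measure_pmf.prob (random_graph n (1/2))
      {G. ereal_of_enat (warmth G) \<ge> ereal ((1 - \<delta>) * log 2 (real n))}) sequentially"
    using eventually_ge_at_top[of 2]
  proof eventually_elim
    case (elim n)
    have l: "1 \<le> log 2 n" using elim by (simp add: le_log_iff)
    define b where "b = nat \<lceil>(1 - \<epsilon>) * log 2 n\<rceil>"
    define s where "s = nat \<lceil>3 * log 2 n\<rceil>"
    \<comment> \<open>Since \<open>b \<le> s\<close>, this exceeds the at most
      \<open>2 * s\<^sup>2\<close> excluded values, yet remains polylogarithmic in
      \<open>n\<close>.\<close>
    define m where "m = 4 * s\<^sup>2"
    have pos: "0 < (1 - \<epsilon>) * log 2 n" using \<epsilon> l by auto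
    have b: "0 < b" "(1 - \<epsilon>) * log 2 n \<le> b" "b \<le> (1 - \<epsilon>) * log 2 n + 1"
      using pos unfolding b_def by linarith+
    have s: "3 * log 2 n \<le> s" "s \<le> 3 * log 2 n + 1"
      using l unfolding s_def by linarith+
    have "(1 - \<epsilon>) * log 2 n \<le> 3 * log 2 n" using \<epsilon> l by (intro mult_right_mono) auto
    then have "b \<le> s" unfolding b_def s_def by (intro nat_mono ceiling_mono)
    have "1 \<le> s" using s l by linarith
    have "real b \<le> 3 * log 2 n + 1" using \<open>b \<le> s\<close> s by linarith
    moreover have "(real s)\<^sup>2 \<le> (3 * log 2 n + 1)\<^sup>2" using s by (intro power_mono) auto
    ultimately have "real (b + m) \<le> q n"
      unfolding m_def q_def of_nat_add of_nat_mult of_nat_power of_nat_numeral by linarith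
    then have "b + m \<le> n" using elim by linarith
    have "s \<le> m" using \<open>1 \<le> s\<close> by (simp add: m_def power2_eq_square)
    have "b * (2 * s) \<le> s * (2 * s)" using \<open>b \<le> s\<close> by (rule mult_right_mono) simp
    also have "\<dots> < m" using \<open>1 \<le> s\<close> by (simp add: m_def power2_eq_square)
    finally have "1 - real n ^ (b + m) * (1 - (1/2) ^ b) ^ (n - (b + m)) - real n ^ (2 * s) * (1/2) ^ (s * s)
        \<le> measure_pmf.prob (random_graph n (1/2)) {G. enat (b + 2) \<le> warmth G}"
      using b \<open>b + m \<le> n\<close> \<open>s \<le> m\<close> by (intro prob_warmth_ge) auto
    moreover have "real n ^ (b + m) * (1 - (1/2) ^ b) ^ (n - (b + m)) \<le> t n"
      unfolding t_def using elim b \<open>real (b + m) \<le> q n\<close> by (intro few_common_nbrs_bound) auto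
    moreover have "real n ^ (2 * s) * (1/2) ^ (s * s) \<le> 1 / n"
      using elim s by (intro no_edge_between_bound)
    moreover have "ereal ((1 - \<delta>) * log 2 n) \<le> ereal_of_enat (warmth G)"
      if "enat (b + 2) \<le> warmth G" for G :: "nat graph"
    proof -
      have "(1 - \<delta>) * log 2 n \<le> (1 - \<epsilon>) * log 2 n" using \<epsilon> l by (intro mult_right_mono) auto
      then have "ereal ((1 - \<delta>) * log 2 n) \<le> ereal_of_enat (enat (b + 2))"
        using b by simp
      also have "\<dots> \<le> ereal_of_enat (warmth G)"
        using that by (simp only: ereal_of_enat_le_iff)
      finally show ?thesis .
    qed
    then have "measure_pmf.prob (random_graph n (1/2)) {G. enat (b + 2) \<le> warmth G} \<le>
        measure_pmf.prob (random_graph n (1/2)) {G. ereal ((1 - \<delta>) * log 2 n) \<le> ereal_of_enat (warmth G)}"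
      by (intro measure_pmf.finite_measure_mono) auto
    ultimately show ?case by linarith
  qed
  then show ?thesis
    by (rule tendsto_sandwich[OF _ _ lim tendsto_const]) simp
qed

end
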